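(* Suppose $\rho$ is a nondegenerate polarity in $V(rn,q)$, let $\mathcal{D}=\mathcal{D}_{r,n,q}$, and let $U,W$ be $\mathbb{F}_q$-subspaces of $V(rn,q)$. Then $(\mathcal{D},U,W)$ is a BEL-configuration if and only if $(\mathcal{D}_{\rho},W^{\rho},U^{\rho})$ is a BEL-configuration.
   Context: Represent $V(rn,q)$, an $rn$-dimensional $\mathbb{F}_q$-space, as $(\mathbb{F}_{q^n})^r$, and let $\mathcal{D}_{r,n,q}$ be the $n$-spread consisting of all one-dimensional $\mathbb{F}_{q^n}$-subspaces of $(\mathbb{F}_{q^n})^r$. An $n$-spread of $V(rn,q)$ (a set of $n$-dimensional subspaces partitioning the nonzero vectors) is Desarguesian if some $\mathbb{F}_q$-linear bijection onto $(\mathbb{F}_{q^n})^r$ maps it to $\mathcal{D}_{r,n,q}$. For a spread $\mathcal{D}$ and a subset $A$, $\mathcal{B}_{\mathcal{D}}(A)$ is the set of elements of $\mathcal{D}$ containing a nonzero vector of $A$. A BEL-configuration in $V(rn,q)$ is a triple $(\mathcal{D},U,W)$ where $\mathcal{D}$ is a Desarguesian $n$-spread, $U$ is an $\mathbb{F}_q$-subspace of dimension $n$, $W$ is an $\mathbb{F}_q$-subspace of dimension $rn-n$, and $\mathcal{B}_{\mathcal{D}}(U)\cap\mathcal{B}_{\mathcal{D}}(W)=\emptyset$. A nondegenerate polarity $\rho$ of $V(rn,q)$ is the map $M\mapsto M^\rho=\{v: b_\rho(u,v)=0\ \forall u\in M\}$ on $\mathbb{F}_q$-subspaces, where $b_\rho$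 is a nondegenerate symmetric bilinear, symplectic (alternating), or hermitian form on $V(rn,q)$. For a spread $\mathcal{D}$, define $\mathcal{D}_\rho=\{H^\rho:\dim(H)=rn-n\text{ and }H\text{ is generated by elements of }\mathcal{D}\}$. *)

theory Defs
  imports "HOL-Analysis.Cartesian_Space"
begin

definition field_embedding :: "('k::field \<Rightarrow> 'l::field) \<Rightarrow> bool" where
  "field_embedding \<phi> \<longleftrightarrow>
     \<phi> 1 = 1 \<and> (\<forall>x y. \<phi> (x + y) = \<phi> x + \<phi> y) \<and> (\<forall>x y. \<phi> (x * y) = \<phi> x * \<phi> y)"

text \<open>
  \<open>V(rn,q)\<close> is the type \<open>'l ^ 'r\<close> with \<open>CARD('k) = q\<close>, \<open>CARD('l) = q ^ n\<close>, \<open>CARD('r) = r\<close>;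
  its structure of a vector space over \<open>'k\<close> comes from an embedding of \<open>'k\<close> into \<open>'l\<close>.
\<close>

definition restr_scale :: "('k::field \<Rightarrow> 'l::field) \<Rightarrow> 'k \<Rightarrow> 'l ^ 'r \<Rightarrow> 'l ^ 'r" where
  "restr_scale \<phi> c v = \<phi> c *s v"

lemma vector_space_restr_scale:
  assumes "field_embedding \<phi>"
  shows "vector_space (restr_scale \<phi> :: 'k::field \<Rightarrow> 'l::field ^ 'r \<Rightarrow> 'l ^ 'r)"
  using assms
  by unfold_locales (simp_all add: field_embedding_def restr_scale_def vec_eq_iff algebra_simps)


section \<open>Spreads\<close>

definition n_spread :: "('k::field \<Rightarrow> 'v::ab_group_add \<Rightarrow> 'v) \<Rightarrow> nat \<Rightarrow> 'v set set \<Rightarrow> bool" where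
  "n_spread s n D \<longleftrightarrow>
     (\<forall>X\<in>D. module.subspace s X \<and> vector_space.dim s X = n) \<and>
     (\<forall>v. v \<noteq> 0 \<longrightarrow> (\<exists>!X. X \<in> D \<and> v \<in> X))"

text \<open>Here \<open>vec\<close> refers to the vector space structure over the large field \<open>'l\<close>.\<close>

definition standard_spread :: "('l::field ^ 'r) set set" where
  "standard_spread = {X. vec.subspace X \<and> vec.dim X = 1}"

definition desarguesian_spread ::
    "('k::field \<Rightarrow> 'l::field) \<Rightarrow> nat \<Rightarrow> ('l ^ 'r) set set \<Rightarrow> bool" where
  "desarguesian_spread \<phi> n D \<longleftrightarrow>
     n_spread (restr_scale \<phi>) n D \<and>
     (\<exists>f :: 'l ^ 'r \<Rightarrow> 'l ^ 'r.
        Vector_Spaces.linear (restr_scale \<phi>) (restr_scale \<phi>) f \<and> bij f \<and>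
        (\<lambda>X. f ` X) ` D = standard_spread)"


section \<open>BEL-configurations\<close>

definition spread_elements_meeting :: "'v::zero set set \<Rightarrow> 'v set \<Rightarrow> 'v set set" where
  "spread_elements_meeting D A = {X \<in> D. \<exists>v\<in>A. v \<noteq> 0 \<and> v \<in> X}"

definition BEL_configuration ::
    "('k::field \<Rightarrow> 'l::field) \<Rightarrow> nat \<Rightarrow> ('l ^ 'r) set set \<Rightarrow> ('l ^ 'r) set \<Rightarrow> ('l ^ 'r) set \<Rightarrow> bool"
  where
  "BEL_configuration \<phi> n D U W \<longleftrightarrow>
     desarguesian_spread \<phi> n D \<and>
     module.subspace (restr_scale \<phi>) U \<and> vector_space.dim (restr_scale \<phi>) U = n \<and>
     module.subspace (restr_scale \<phi>) W \<and>
       vector_space.dim (restr_scale \<phi>) W = CARD('r) * n - n \<and>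
     spread_elements_meeting D U \<inter> spread_elements_meeting D W = {}"


section \<open>Polarities\<close>

definition nondegenerate_form :: "('v::zero \<Rightarrow> 'v \<Rightarrow> 'k::zero) \<Rightarrow> bool" where
  "nondegenerate_form b \<longleftrightarrow> (\<forall>v. (\<forall>u. b u v = 0) \<longrightarrow> v = 0)"

definition bilinear_form ::
    "('k::field \<Rightarrow> 'v::ab_group_add \<Rightarrow> 'v) \<Rightarrow> ('v \<Rightarrow> 'v \<Rightarrow> 'k) \<Rightarrow> bool" where
  "bilinear_form s b \<longleftrightarrow>
     (\<forall>v. Vector_Spaces.linear s (*) (\<lambda>u. b u v)) \<and>
     (\<forall>u. Vector_Spaces.linear s (*) (\<lambda>v. b u v))"

definition symmetric_bilinear_form ::
    "('k::field \<Rightarrow> 'v::ab_group_add \<Rightarrow> 'v) \<Rightarrow> ('v \<Rightarrow> 'v \<Rightarrow> 'k) \<Rightarrow> bool" where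
  "symmetric_bilinear_form s b \<longleftrightarrow> bilinear_form s b \<and> (\<forall>u v. b u v = b v u)"

definition alternating_form ::
    "('k::field \<Rightarrow> 'v::ab_group_add \<Rightarrow> 'v) \<Rightarrow> ('v \<Rightarrow> 'v \<Rightarrow> 'k) \<Rightarrow> bool" where
  "alternating_form s b \<longleftrightarrow> bilinear_form s b \<and> (\<forall>v. b v v = 0)"

text \<open>
  The companion automorphism \<open>\<sigma>\<close> has order exactly two; semilinearity in the second argument
  follows from the two conditions on \<open>b\<close>.
\<close>

definition hermitian_form ::
    "('k::field \<Rightarrow> 'v::ab_group_add \<Rightarrow> 'v) \<Rightarrow> ('v \<Rightarrow> 'v \<Rightarrow> 'k) \<Rightarrow> bool" where
  "hermitian_form s b \<longleftrightarrow>
     (\<exists>\<sigma>. field_embedding \<sigma> \<and> \<sigma> \<circ> \<sigma> = id \<and> \<sigma> \<noteq> id \<and>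
        (\<forall>v. Vector_Spaces.linear s (*) (\<lambda>u. b u v)) \<and>
        (\<forall>u v. b v u = \<sigma> (b u v)))"

text \<open>
  A polarity is a map on subspaces, so its values on other sets are left unconstrained.
\<close>

definition nondegenerate_polarity ::
    "('k::field \<Rightarrow> 'v::ab_group_add \<Rightarrow> 'v) \<Rightarrow> ('v set \<Rightarrow> 'v set) \<Rightarrow> bool" where
  "nondegenerate_polarity s \<rho> \<longleftrightarrow>
     (\<exists>b. nondegenerate_form b \<and>
        (symmetric_bilinear_form s b \<or> alternating_form s b \<or> hermitian_form s b) \<and>
        (\<forall>M. module.subspace s M \<longrightarrow> \<rho> M = {v. \<forall>u\<in>M. b u v = 0}))"

text \<open>
  For \<open>r = 1\<close> the only subspace of dimension \<open>rn - n\<close> is zero, generated by the empty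
  subset of \<open>D\<close>.
\<close>

definition dual_spread ::
    "('k::field \<Rightarrow> 'l::field) \<Rightarrow> nat \<Rightarrow> (('l ^ 'r) set \<Rightarrow> ('l ^ 'r) set)
      \<Rightarrow> ('l ^ 'r) set set \<Rightarrow> ('l ^ 'r) set set" where
  "dual_spread \<phi> n \<rho> D =
     {\<rho> H | H. vector_space.dim (restr_scale \<phi>) H = CARD('r) * n - n \<and>
              (\<exists>S\<subseteq>D. H = module.span (restr_scale \<phi>) (\<Union>S))}"

end

theory Submission
  imports Defs "HOL-Computational_Algebra.Polynomial"
begin

text \<open>
  Write \<open>K\<close> and \<open>L\<close> for the small and the large field, \<open>V = L ^ r\<close>, and let \<open>D\<close> be the
  standard spread. Fix a \<open>K\<close>-linear \<open>lam : L \<rightarrow> K\<close> with \<open>lam 1 = 1\<close>. Then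
  \<open>B u v = lam (u \<bullet> v)\<close>, with the dot product of \<open>L ^ r\<close>, is a nondegenerate symmetric
  \<open>K\<close>-bilinear form whose orthogonality sends \<open>L\<close>-subspaces to \<open>L\<close>-subspaces. For it the
  theorem is transparent: the orthogonal spaces of the \<open>L\<close>-hyperplanes are exactly the elements
  of \<open>D\<close> (\<open>perp_hyperplanes_eq_standard_spread\<close>), and a counting argument shows that
  subspaces \<open>U\<close> and \<open>W\<close> of dimensions \<open>n\<close> and \<open>rn - n\<close> meet a common element of
  \<open>D\<close> if and only if their orthogonal spaces do
  (\<open>common_line_perps_iff\<close>).

  An arbitrary polarity differs from this one by a change of coordinates. A nondegenerate
  form \<open>b\<close> of one of the three kinds can be written \<open>b u v = B u (T v)\<close>, and \<open>T\<close> is a bijection that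
  is semilinear for an automorphism \<open>\<sigma>\<close> of \<open>K\<close> with \<open>\<sigma> \<circ> \<sigma> = id\<close>
  (\<open>form_eq_functional_form_semilinear\<close>). So \<open>M\<^sup>\<rho>\<close> is the preimage under \<open>T\<close> of the
  \<open>B\<close>-orthogonal space of \<open>M\<close>, the dual spread is the preimage of \<open>D\<close>, and BEL-configurations
  can be transported along \<open>T\<close> (\<open>BEL_preimage_iff\<close>).

  One point needs care: a Desarguesian spread must be carried to \<open>D\<close> by a \<open>K\<close>-linear map, and in
  the hermitian case \<open>T\<close> is not linear. The remedy is to extend \<open>\<sigma>\<close> to an automorphism of \<open>L\<close>
  (\<open>involution_extends\<close>); applied to the coordinates, the extension preserves \<open>D\<close>, and
  composed with \<open>T\<close> it gives a \<open>K\<close>-linear map.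

  Dimensions are compared through cardinalities: a \<open>K\<close>-subspace of dimension \<open>m\<close> is one
  with \<open>q ^ m\<close> elements.
\<close>

section \<open>Finite vector spaces and nondegenerate pairings\<close>

locale finite_vector_space = vector_space scale
  for scale :: "'k::{field,finite} \<Rightarrow> 'v::{ab_group_add,finite} \<Rightarrow> 'v"
begin

text \<open>
  Both the cardinality of a subspace and that of the kernel of a functional come from this one
  step: adjoining a vector to a subspace multiplies its size by \<open>q\<close>.
\<close>

lemma card_extend_by_vector:
  assumes "subspace N" and "a \<notin> N"
  shows "card ((\<lambda>(c, x). scale c a + x) ` (UNIV \<times> N)) = CARD('k) * card N"
proof -
  have "inj_on (\<lambda>(c, x). scale c a + x) (UNIV \<times> N)"
  proof (rule inj_onI, clarify)
    fix c d x y
    assume x: "x \<in> N" and y: "y \<in> N" and eq: "scale c a + x = scale d a + y"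
    have "scale (c - d) a = y - x"
      using eq by (simp add: scale_left_diff_distrib algebra_simps)
    then have mem: "scale (c - d) a \<in> N"
      using assms(1) x y subspace_diff by simp
    have "c = d"
    proof (rule ccontr)
      assume "c \<noteq> d"
      then have "a = scale (inverse (c - d)) (scale (c - d) a)" by simp
      then show False using mem assms subspace_scale by metis
    qed
    then show "c = d \<and> x = y" using eq by simp
  qed
  then have "card ((\<lambda>(c, x). scale c a + x) ` (UNIV \<times> N)) = card (UNIV \<times> N :: ('k \<times> 'v) set)"
    by (rule card_image)
  then show ?thesis by (simp add: card_cartesian_product)
qed

lemma card_span_independent:
  assumes "independent B"
  shows "card (span B) = CARD('k) ^ card B"
proof -
  have "finite B" by simp
  then show ?thesis using assms
  proof (induction B rule: finite_induct)
    case empty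
    then show ?case by simp
  next
    case (insert a B)
    then have ind: "independent B" and a: "a \<notin> span B"
      by (auto simp: independent_insert)
    have "span (insert a B) = (\<lambda>(c, x). scale c a + x) ` (UNIV \<times> span B)"
    proof (intro set_eqI iffI)
      fix x assume "x \<in> span (insert a B)"
      then obtain c where "x - scale c a \<in> span B" by (auto simp: span_breakdown_eq)
      then show "x \<in> (\<lambda>(c, x). scale c a + x) ` (UNIV \<times> span B)"
        by (intro image_eqI[of _ _ "(c, x - scale c a)"]) auto
    next
      fix x assume "x \<in> (\<lambda>(c, x). scale c a + x) ` (UNIV \<times> span B)"
      then obtain c y where "x = scale c a + y" "y \<in> span B" by auto
      then have "x - scale c a \<in> span B" by simp
      then show "x \<in> span (insert a B)" by (auto simp: span_breakdown_eq)
    qed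
    then show ?case
      using card_extend_by_vector[OF subspace_span a] insert ind by simp
  qed
qed

lemma card_subspace:
  assumes "subspace X"
  shows "card X = CARD('k) ^ dim X"
proof -
  obtain B where "B \<subseteq> X" "independent B" "X \<subseteq> span B" "card B = dim X"
    using basis_exists by blast
  then show ?thesis
    using card_span_independent[of B] span_subspace[of B X] assms by simp
qed

lemma card_field_ge_2: "2 \<le> CARD('k)"
proof -
  have "card {0, 1 :: 'k} \<le> CARD('k)" by (rule card_mono) auto
  then show ?thesis by simp
qed

lemma dim_eq_iff_card:
  assumes "subspace X"
  shows "dim X = m \<longleftrightarrow> card X = CARD('k) ^ m"
  using card_subspace[OF assms] card_field_ge_2 by (auto simp: power_inject_exp)

lemma card_kernel:
  assumes W: "subspace W"
    and add: "\<And>x y. g (x + y) = g x + g y"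
    and scale: "\<And>c x. g (scale c x) = c * (g x :: 'k)"
    and w: "w \<in> W" "g w \<noteq> 0"
  shows "CARD('k) * card {x \<in> W. g x = 0} = card W"
proof -
  let ?N = "{x \<in> W. g x = 0}"
  have g0: "g 0 = 0" using scale[of 0 0] by simp
  have N: "subspace ?N"
    by (rule subspaceI)
      (use W add scale g0 subspace_0 subspace_add subspace_scale in auto)
  have "W = (\<lambda>(c, x). scale c w + x) ` (UNIV \<times> ?N)"
  proof (intro set_eqI iffI)
    fix x assume x: "x \<in> W"
    let ?c = "g x / g w"
    have eq: "g (x - scale ?c w) = 0"
      using add[of "x - scale ?c w" "scale ?c w"] scale w by simp
    moreover have "x - scale ?c w \<in> W"
      using x w W subspace_diff subspace_scale by blast
    ultimately show "x \<in> (\<lambda>(c, x). scale c w + x) ` (UNIV \<times> ?N)"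
      by (intro image_eqI[of _ _ "(?c, x - scale ?c w)"]) auto
  qed (use w W subspace_add subspace_scale in auto)
  then show ?thesis using card_extend_by_vector[OF N, of w] w by simp
qed

end

locale finite_pairing = finite_vector_space scale
  for scale :: "'k::{field,finite} \<Rightarrow> 'v::{ab_group_add,finite} \<Rightarrow> 'v" +
  fixes B :: "'v \<Rightarrow> 'v \<Rightarrow> 'k"
  assumes B_commute: "B u v = B v u"
    and B_add_left: "B (u + u') v = B u v + B u' v"
    and B_scale_left: "B (scale c u) v = c * B u v"
    and nondegenerate: "(\<And>u. B u v = 0) \<Longrightarrow> v = 0"
begin

definition perp :: "'v set \<Rightarrow> 'v set" where
  "perp M = {v. \<forall>u\<in>M. B u v = 0}"

lemma B_add_right: "B u (v + v') = B u v + B u v'"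
  using B_commute B_add_left by metis

lemma B_scale_right: "B u (scale c v) = c * B u v"
  using B_commute B_scale_left by metis

lemma B_zero_left [simp]: "B 0 v = 0"
  using B_scale_left[of 0 0 v] by simp

lemma B_zero_right [simp]: "B v 0 = 0"
  using B_commute B_zero_left by metis

lemma subspace_perp: "subspace (perp M)"
  by (rule subspaceI) (auto simp: perp_def B_add_right B_scale_right)

text \<open>
  Count the orthogonal pairs in \<open>W \<times> V\<close> in two ways. The orthogonal vectors of a
  nonzero \<open>w\<close> make up the fraction \<open>1/q\<close> of \<open>V\<close>; a vector is orthogonal to
  all of \<open>W\<close> if it lies in \<open>perp W\<close>, and to the fraction \<open>1/q\<close> of \<open>W\<close> otherwise.
\<close>

lemma card_perp:
  assumes W: "subspace W"
  shows "card W * card (perp W) = CARD('v)"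
proof -
  let ?q = "int CARD('k)" and ?V = "int CARD('v)" and ?W = "int (card W)"
    and ?A = "int (card (perp W))"
  have row: "?q * int (card {v. B w v = 0}) = (if w = 0 then ?q * ?V else ?V)" for w
  proof (cases "w = 0")
    case False
    then obtain v where "B w v \<noteq> 0" using nondegenerate[of w] B_commute by metis
    then have "CARD('k) * card {x \<in> UNIV. B w x = 0} = CARD('v)"
      by (intro card_kernel subspace_UNIV B_add_right B_scale_right) auto
    then show ?thesis using False by (simp flip: of_nat_mult)
  qed simp
  have col: "?q * int (card {w \<in> W. B w v = 0}) = (if v \<in> perp W then ?q * ?W else ?W)" for v
  proof (cases "v \<in> perp W")
    case True
    then have "{w \<in> W. B w v = 0} = W" by (auto simp: perp_def)
    then show ?thesis using True by simp
  next
    case False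
    then obtain w where "w \<in> W" "B w v \<noteq> 0" by (auto simp: perp_def)
    then have "CARD('k) * card {w \<in> W. B w v = 0} = card W"
      by (intro card_kernel W B_add_left B_scale_left) auto
    then show ?thesis using False by (simp flip: of_nat_mult)
  qed
  have "(\<Sum>w\<in>W. card {v. B w v = 0}) = (\<Sum>w\<in>W. \<Sum>v\<in>UNIV. if B w v = 0 then 1 else 0)"
    by (simp add: sum.If_cases)
  also have "\<dots> = (\<Sum>v\<in>UNIV. \<Sum>w\<in>W. if B w v = 0 then 1 else 0)"
    by (rule sum.swap)
  also have "\<dots> = (\<Sum>v\<in>UNIV. card {w \<in> W. B w v = 0})"
    by (simp add: sum.If_cases Int_def)
  finally have "?q * (\<Sum>w\<in>W. int (card {v. B w v = 0}))
      = ?q * (\<Sum>v\<in>UNIV. int (card {w \<in> W. B w v = 0}))"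
    by (simp flip: of_nat_sum)
  then have "(\<Sum>w\<in>W. if w = 0 then ?q * ?V else ?V)
      = (\<Sum>v\<in>UNIV. if v \<in> perp W then ?q * ?W else ?W)"
    by (simp add: sum_distrib_left row col)
  moreover have "(\<Sum>w\<in>W. if w = 0 then ?q * ?V else ?V) = ?q * ?V + (?W - 1) * ?V"
  proof -
    have z: "0 \<in> W" using W subspace_0 by blast
    then have "card W > 0" by (auto simp: card_gt_0_iff)
    moreover have "(\<Sum>w\<in>W. if w = 0 then ?q * ?V else ?V)
        = ?q * ?V + (\<Sum>w\<in>W - {0}. if w = 0 then ?q * ?V else ?V)"
      using z by (subst sum.remove[of _ 0]) auto
    moreover have "(\<Sum>w\<in>W - {0}. if w = 0 then ?q * ?V else ?V) = (\<Sum>w\<in>W - {0}. ?V)"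
      by (intro sum.cong) auto
    ultimately show ?thesis
      using z by (simp add: of_nat_diff Suc_leI)
  qed
  moreover have "(\<Sum>v\<in>UNIV. if v \<in> perp W then ?q * ?W else ?W)
      = ?A * (?q * ?W) + (?V - ?A) * ?W"
  proof -
    have "card (- perp W) = CARD('v) - card (perp W)"
      by (simp add: Compl_eq_Diff_UNIV card_Diff_subset)
    then have "int (card (- perp W)) = ?V - ?A"
      by (simp add: of_nat_diff card_mono)
    then show ?thesis by (simp add: sum.If_cases)
  qed
  ultimately have "(?q - 1) * (?W * ?A) = (?q - 1) * ?V"
    by (simp add: algebra_simps)
  then have "?W * ?A = ?V" using card_field_ge_2 by simp
  then show ?thesis by (metis of_nat_eq_iff of_nat_mult)
qed

lemma perp_perp:
  assumes "subspace W"
  shows "perp (perp W) = W"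
proof -
  have "W \<subseteq> perp (perp W)" by (auto simp: perp_def B_commute)
  moreover have "card W = card (perp (perp W))"
  proof -
    have "card (perp W) * card W = card (perp W) * card (perp (perp W))"
      using card_perp[OF assms] card_perp[OF subspace_perp, of W] by (simp add: mult.commute)
    moreover have "card (perp W) \<noteq> 0"
      using card_perp[OF assms] by (metis mult_0_right finite_UNIV_card_ge_0 finite less_irrefl)
    ultimately show ?thesis by simp
  qed
  ultimately show ?thesis by (metis card_subset_eq finite)
qed

text \<open>
  The kernel of a nonzero functional is a hyperplane, so its orthogonal space has \<open>q\<close>
  elements; a nonzero one of them, suitably rescaled, represents the functional.
\<close>

lemma riesz_representation:
  assumes add: "\<And>x y. g (x + y) = g x + g y"
    and scale: "\<And>c x. g (scale c x) = c * (g x :: 'k)"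
  shows "\<exists>a. \<forall>u. g u = B u a"
proof (cases "\<forall>u. g u = 0")
  case True
  then show ?thesis by (intro exI[of _ 0]) simp
next
  case False
  then obtain w where w: "g w \<noteq> 0" by blast
  let ?H = "{x. g x = 0}"
  have g0: "g 0 = 0" using scale[of 0 0] by simp
  have H: "subspace ?H" by (rule subspaceI) (auto simp: g0 add scale)
  have "CARD('k) * card {x \<in> UNIV. g x = 0} = CARD('v)"
    by (rule card_kernel[where w = w]) (use add scale w subspace_UNIV in auto)
  then have "CARD('k) * card ?H = card ?H * card (perp ?H)"
    using card_perp[OF H] by simp
  moreover have "card ?H \<noteq> 0" using g0 by (auto simp: card_eq_0_iff)
  ultimately have "card (perp ?H) = CARD('k)" by (metis mult.commute mult_cancel1)
  then have "perp ?H \<noteq> {0}" using card_field_ge_2 by auto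
  then obtain a where a: "a \<in> perp ?H" "a \<noteq> 0"
    using subspace_0[OF subspace_perp] by blast
  have multiple: "B u a * g w = g u * B w a" for u
  proof -
    have dec: "u = (u - scale (g u / g w) w) + scale (g u / g w) w" by simp
    then have "g u = g (u - scale (g u / g w) w) + (g u / g w) * g w"
      using assms by metis
    moreover have eq: "B u a = B (u - scale (g u / g w) w) a + (g u / g w) * B w a"
      using dec B_add_left B_scale_left by metis
    ultimately have "u - scale (g u / g w) w \<in> ?H" using w by simp
    then have "B (u - scale (g u / g w) w) a = 0" using a by (auto simp: perp_def)
    then show ?thesis using eq w by simp
  qed
  have "B w a \<noteq> 0"
    using multiple w nondegenerate[of a] a by auto
  then have "g u = B u (scale (g w / B w a) a)" for u
    using multiple[of u] by (simp add: B_scale_right field_simps)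
  then show ?thesis by blast
qed

end

section \<open>Involutions of finite fields\<close>

lemma binomial_split:
  fixes x y :: "'l::comm_ring_1"
  assumes "0 < m"
  shows "(x + y) ^ m = x ^ m + y ^ m + (\<Sum>i\<in>{0<..<m}. of_nat (m choose i) * x ^ i * y ^ (m - i))"
proof -
  have "(x + y) ^ m = (\<Sum>i\<le>m. of_nat (m choose i) * x ^ i * y ^ (m - i))"
    by (rule binomial_ring)
  also have "{..m} = insert 0 (insert m {0<..<m})" using assms by auto
  finally show ?thesis using assms by (simp add: algebra_simps)
qed

text \<open>
  With \<open>m\<close> the size of \<open>F\<close>, the polynomial \<open>(x + 1) ^ m - x ^ m - 1\<close> has degree less than
  \<open>m\<close> and vanishes on all \<open>m\<close> elements of \<open>F\<close>, so its coefficients are zero. Hence the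
  \<open>m\<close>-th power is additive, and as a statement on the numbers \<open>m choose i\<close> this passes to
  every extension field.
\<close>

lemma of_nat_binomial_eq_0_if_power_fixes:
  fixes F :: "'k::{field,finite} set"
  assumes "\<And>x. x \<in> F \<Longrightarrow> x + 1 \<in> F" and "\<And>x. x \<in> F \<Longrightarrow> x ^ card F = x"
    and "0 < i" "i < card F"
  shows "of_nat (card F choose i) = (0 :: 'k)"
proof -
  let ?m = "card F"
  let ?p = "(\<Sum>i\<in>{0<..<?m}. monom (of_nat (?m choose i)) i) :: 'k poly"
  have deg: "degree ?p < ?m"
    using assms(3,4) by (intro degree_sum_less le_less_trans[OF degree_monom_le]) auto
  have binom: "(x + 1) ^ ?m = 1 + poly ?p x + x ^ ?m" for x :: 'k
    using binomial_split[of ?m x 1] assms(3,4) by (simp add: poly_sum poly_monom)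
  have "poly ?p x = 0" if "x \<in> F" for x
    using binom[of x] assms(1,2) that by simp
  then have sub: "F \<subseteq> {x. poly ?p x = 0}" by auto
  have "?p = 0"
  proof (rule ccontr)
    assume "?p \<noteq> 0"
    then have "card {x. poly ?p x = 0} \<le> degree ?p" by (rule card_poly_roots_bound)
    then show False using card_mono[OF _ sub] deg by simp
  qed
  then have "coeff ?p i = 0" by simp
  then show ?thesis using assms(3,4) by (simp add: coeff_sum)
qed

lemma power_add_if_binomials_vanish:
  fixes x y :: "'l::comm_ring_1"
  assumes "\<And>i. 0 < i \<Longrightarrow> i < m \<Longrightarrow> of_nat (m choose i) = (0 :: 'l)" and "0 < m"
  shows "(x + y) ^ m = x ^ m + y ^ m"
  using binomial_split[OF assms(2), of x y] assms(1) by (simp add: sum.neutral)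

text \<open>
  Lagrange's argument for a multiplicatively closed set: multiplication by a nonzero \<open>x\<close>
  permutes the nonzero elements, so their product does not change.
\<close>

lemma power_card_eq_if_mult_closed:
  fixes F :: "'k::{field,finite} set"
  assumes "0 \<in> F" and mult: "\<And>x y. x \<in> F \<Longrightarrow> y \<in> F \<Longrightarrow> x * y \<in> F" and x: "x \<in> F"
  shows "x ^ card F = x"
proof (cases "x = 0")
  case True
  then show ?thesis using x by (auto simp: power_0_left card_eq_0_iff)
next
  case False
  let ?U = "F - {0}"
  have inj: "inj_on ((*) x) ?U" using False by (auto intro: inj_onI)
  have "(*) x ` ?U \<subseteq> ?U" using False mult x by auto
  then have "(*) x ` ?U = ?U" using inj by (intro endo_inj_surj) auto
  then have "prod id ?U = (\<Prod>y\<in>?U. x * y)"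
    using prod.reindex[OF inj, of id] by (simp add: comp_def)
  also have "\<dots> = x ^ card ?U * prod id ?U" by (simp add: prod.distrib)
  finally have "x ^ card ?U = 1" by simp
  moreover have "card F = Suc (card ?U)"
    using card_Suc_Diff1[OF _ assms(1)] by simp
  ultimately show ?thesis by simp
qed

lemma field_embedding_0: "field_embedding \<phi> \<Longrightarrow> \<phi> 0 = 0"
  unfolding field_embedding_def by (metis add_cancel_right_left)

lemma field_embedding_eq_0_iff:
  assumes "field_embedding \<phi>"
  shows "\<phi> x = 0 \<longleftrightarrow> x = 0"
proof
  assume "\<phi> x = 0"
  show "x = 0"
  proof (rule ccontr)
    assume "x \<noteq> 0"
    then have "\<phi> 1 = \<phi> x * \<phi> (inverse x)"
      using assms unfolding field_embedding_def by (metis right_inverse)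
    then show False using assms \<open>\<phi> x = 0\<close> by (simp add: field_embedding_def)
  qed
qed (simp add: field_embedding_0 assms)

lemma field_embedding_diff:
  assumes "field_embedding \<phi>"
  shows "\<phi> (x - y) = \<phi> x - \<phi> y"
  using assms unfolding field_embedding_def by (metis add_diff_cancel diff_add_cancel)

lemma inj_field_embedding:
  assumes "field_embedding \<phi>"
  shows "inj \<phi>"
  by (rule injI) (metis assms field_embedding_diff field_embedding_eq_0_iff right_minus_eq)

lemma field_embedding_of_nat:
  assumes "field_embedding \<phi>"
  shows "\<phi> (of_nat m) = of_nat m"
  using assms field_embedding_0[OF assms]
  by (induction m) (simp_all add: field_embedding_def)

lemma field_embedding_power:
  assumes "field_embedding \<phi>"
  shows "\<phi> (x ^ m) = \<phi> x ^ m"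
  using assms by (induction m) (simp_all add: field_embedding_def)

text \<open>
  Let \<open>F\<close> be the fixed field of \<open>\<sigma>\<close> and \<open>m\<close> its size. The \<open>m\<close>-th power is a ring
  endomorphism that fixes \<open>F\<close> pointwise. If \<open>x\<close> is not in \<open>F\<close>, then \<open>x\<close> is a root of
  \<open>X\<^sup>2 - (x + \<sigma> x) X + x \<sigma> x\<close>, whose coefficients are in \<open>F\<close>; hence so is \<open>x ^ m\<close>, and
  it is one of \<open>x\<close> and \<open>\<sigma> x\<close>. It is not \<open>x\<close>, because \<open>X ^ m - X\<close> already has its
  \<open>m\<close> roots in \<open>F\<close>.
\<close>

lemma involution_eq_power:
  fixes \<sigma> :: "'k::{field,finite} \<Rightarrow> 'k"
  assumes \<sigma>: "field_embedding \<sigma>" and inv: "\<sigma> \<circ> \<sigma> = id"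
  defines "m \<equiv> card {x. \<sigma> x = x}"
  shows "1 < m" and "0 < i \<Longrightarrow> i < m \<Longrightarrow> of_nat (m choose i) = (0 :: 'k)"
    and "\<sigma> x = x ^ m"
proof -
  let ?F = "{x. \<sigma> x = x}"
  have hom: "\<sigma> (x + y) = \<sigma> x + \<sigma> y" "\<sigma> (x * y) = \<sigma> x * \<sigma> y" "\<sigma> 1 = 1" for x y
    using \<sigma> by (auto simp: field_embedding_def)
  have inv': "\<sigma> (\<sigma> x) = x" for x using inv by (metis comp_apply id_apply)
  have "card {0, 1 :: 'k} \<le> m"
    unfolding m_def by (rule card_mono) (auto simp: hom field_embedding_0[OF \<sigma>])
  then show m: "1 < m" by simp
  have pow: "x ^ m = x" if "\<sigma> x = x" for x
    unfolding m_def
    by (rule power_card_eq_if_mult_closed) (use that in \<open>auto simp: hom field_embedding_0[OF \<sigma>]\<close>)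
  show binom: "of_nat (m choose i) = (0 :: 'k)" if "0 < i" "i < m" for i
    unfolding m_def
    by (rule of_nat_binomial_eq_0_if_power_fixes)
      (use that pow in \<open>auto simp: hom m_def\<close>)
  have padd: "(x + y) ^ m = x ^ m + y ^ m" for x y :: 'k
    using power_add_if_binomials_vanish[of m x y] binom m by simp
  show "\<sigma> x = x ^ m"
  proof (cases "\<sigma> x = x")
    case True
    then show ?thesis using pow by simp
  next
    case False
    \<comment> \<open>\<open>?p\<close> is \<open>X ^ m - X\<close>.\<close>
    let ?p = "monom 1 m - [:0, 1:] :: 'k poly"
    let ?s = "x + \<sigma> x" and ?t = "x * \<sigma> x"
    have deg: "degree ?p \<le> m"
      using m by (intro degree_diff_le degree_monom_le) simp
    have "coeff ?p m = 1" using m by (simp add: coeff_pCons split: nat.split)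
    then have "?p \<noteq> 0" by (metis coeff_0 zero_neq_one)
    then have roots: "card {y. poly ?p y = 0} \<le> m"
      using card_poly_roots_bound[of ?p] deg by simp
    have ne: "x ^ m \<noteq> x"
    proof
      assume "x ^ m = x"
      then have "insert x ?F \<subseteq> {y. poly ?p y = 0}" using pow by (auto simp: poly_monom)
      then have "card (insert x ?F) \<le> card {y. poly ?p y = 0}"
        by (intro card_mono) auto
      moreover have "card (insert x ?F) = Suc m" using False by (simp add: m_def)
      ultimately show False using roots by simp
    qed
    \<comment> \<open>Raise the quadratic equation of \<open>x\<close> to the \<open>m\<close>-th power.\<close>
    have "?s ^ m = ?s" and "?t ^ m = ?t"
      by (rule pow; simp add: hom inv' algebra_simps)+
    moreover have "x * x + ?t = ?s * x" by (simp add: algebra_simps)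
    then have "x ^ m * x ^ m + ?t ^ m = ?s ^ m * x ^ m"
      by (metis padd power_mult_distrib)
    ultimately have "x ^ m * x ^ m + x * \<sigma> x = (x + \<sigma> x) * x ^ m" by simp
    then have "(x ^ m - x) * (x ^ m - \<sigma> x) = 0"
      by (simp add: algebra_simps)
    then show ?thesis using ne by simp
  qed
qed

text \<open>
  The extension is \<open>x \<mapsto> x ^ m\<close>, with the exponent \<open>m\<close> of the preceding lemma.
\<close>

lemma involution_extends:
  fixes \<phi> :: "'k::{field,finite} \<Rightarrow> 'l::{field,finite}"
  assumes \<phi>: "field_embedding \<phi>" and "field_embedding \<sigma>" and "\<sigma> \<circ> \<sigma> = id"
  shows "\<exists>\<tau>. field_embedding \<tau> \<and> (\<forall>c. \<tau> (\<phi> c) = \<phi> (\<sigma> c))"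
proof -
  define m where "m = card {x. \<sigma> x = x}"
  note m = involution_eq_power[OF assms(2,3), folded m_def]
  have "of_nat (m choose i) = (0 :: 'l)" if "0 < i" "i < m" for i
    using field_embedding_of_nat[OF \<phi>] field_embedding_0[OF \<phi>] m(2)[OF that] by metis
  then have "(x + y) ^ m = x ^ m + y ^ m" for x y :: 'l
    using power_add_if_binomials_vanish[of m x y] m(1) by simp
  then have "field_embedding (\<lambda>x :: 'l. x ^ m)"
    by (simp add: field_embedding_def power_mult_distrib)
  then show ?thesis
    using m(3) field_embedding_power[OF \<phi>] by (metis (no_types, lifting))
qed

section \<open>The standard spread and its dual\<close>

definition dot :: "'l::field ^ 'r \<Rightarrow> 'l ^ 'r \<Rightarrow> 'l" where
  "dot u v = (\<Sum>i\<in>UNIV. u $ i * v $ i)"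

lemma dot_commute: "dot u v = dot v u"
  by (simp add: dot_def mult.commute)

lemma dot_add_left: "dot (u + u') v = dot u v + dot u' v"
  by (simp add: dot_def distrib_right sum.distrib)

lemma dot_scale_left: "dot (a *s u) v = a * dot u v"
  by (simp add: dot_def sum_distrib_left mult.assoc)

lemma dot_add_right: "dot u (v + v') = dot u v + dot u v'"
  by (metis dot_commute dot_add_left)

lemma dot_scale_right: "dot u (a *s v) = a * dot u v"
  by (metis dot_commute dot_scale_left)

lemma dot_axis_left: "dot (axis i a) v = a * v $ i"
  by (simp add: dot_def axis_def if_distrib[of "\<lambda>x. x * _"] cong: if_cong)

interpretation large: finite_vector_space "(*s) :: 'l::{field,finite} \<Rightarrow> 'l ^ 'r \<Rightarrow> 'l ^ 'r"
  by unfold_locales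

lemma standard_spread_iff:
  fixes X :: "('l::{field,finite} ^ 'r) set"
  shows "X \<in> standard_spread \<longleftrightarrow> vec.subspace X \<and> card X = CARD('l)"
  using large.dim_eq_iff_card[of X 1] by (auto simp: standard_spread_def)

lemma line_in_standard_spread:
  fixes v :: "'l::{field,finite} ^ 'r"
  assumes "v \<noteq> 0"
  shows "vec.span {v} \<in> standard_spread"
  using assms by (simp add: standard_spread_def vec.dim_eq_card_independent
    vec.dependent_single)

lemma standard_spread_unique:
  fixes v :: "'l::{field,finite} ^ 'r"
  assumes X: "X \<in> standard_spread" and "v \<in> X" "v \<noteq> 0"
  shows "X = vec.span {v}"
proof -
  have "vec.span {v} \<subseteq> X"
    using assms by (intro vec.span_minimal) (auto simp: standard_spread_iff)
  moreover have "card (vec.span {v}) = card X"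
    using line_in_standard_spread[OF assms(3)] X by (simp add: standard_spread_iff)
  ultimately show ?thesis by (metis card_subset_eq finite)
qed

text \<open>
  Any \<open>K\<close>-linear functional \<open>lam\<close> on \<open>L\<close> that is 1 at 1 serves here; it takes the place of the
  field trace. The form \<open>B\<close> is a parameter in order to fix the index type of the coordinates.
  Plain names such as \<open>subspace\<close>, \<open>dim\<close> and \<open>span\<close> refer to \<open>V\<close> as a space over \<open>K\<close>,
  names with the prefix \<open>vec\<close> to \<open>V\<close> over \<open>L\<close>, and names with the prefix \<open>small\<close> to
  \<open>L\<close> over \<open>K\<close>.
\<close>

locale functional_form =
  fixes \<phi> :: "'k::{field,finite} \<Rightarrow> 'l::{field,finite}"
    and n :: nat
    and lam :: "'l \<Rightarrow> 'k"
    and B :: "'l ^ 'r \<Rightarrow> 'l ^ 'r \<Rightarrow> 'k"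
  assumes embedding: "field_embedding \<phi>"
    and card_large: "CARD('l) = CARD('k) ^ n"
    and lam_add: "lam (x + y) = lam x + lam y"
    and lam_scale: "lam (\<phi> c * x) = c * lam x"
    and lam_1: "lam 1 = 1"
    and B_eq: "B u v = lam (dot u v)"
begin

lemma functional_pairing_nondegenerate:
  assumes "\<And>a. lam (a * x) = 0"
  shows "x = 0"
proof (rule ccontr)
  assume "x \<noteq> 0"
  then have "lam (inverse x * x) = 1" using lam_1 by simp
  then show False using assms by simp
qed

sublocale vector_space "restr_scale \<phi> :: 'k \<Rightarrow> 'l ^ 'r \<Rightarrow> 'l ^ 'r"
  using embedding by (rule vector_space_restr_scale)

sublocale finite_pairing "restr_scale \<phi>" B
proof
  fix u u' v :: "'l ^ 'r" and c :: 'k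
  show "B u v = B v u" by (simp add: B_eq dot_commute)
  show "B (u + u') v = B u v + B u' v" by (simp add: B_eq dot_add_left lam_add)
  show "B (restr_scale \<phi> c u) v = c * B u v"
    by (simp add: B_eq restr_scale_def dot_scale_left lam_scale)
  show "v = 0" if "\<And>u. B u v = 0"
  proof -
    have "lam (a * v $ i) = 0" for a i
      using that[of "axis i a"] by (simp add: B_eq dot_axis_left)
    then show ?thesis
      using functional_pairing_nondegenerate by (simp add: vec_eq_iff)
  qed
qed

sublocale small: finite_pairing "\<lambda>c x. \<phi> c * x" "\<lambda>x y. lam (x * y)"
proof unfold_locales
  fix u u' v :: 'l and c :: 'k
  show "lam (\<phi> c * u * v) = c * lam (u * v)" by (simp add: mult.assoc lam_scale)
  show "v = 0" if "\<And>u. lam (u * v) = 0" using that by (rule functional_pairing_nondegenerate)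
qed (use embedding in \<open>auto simp: field_embedding_def distrib_left distrib_right mult.assoc mult.commute lam_add\<close>)

lemma subspace_if_large_subspace: "vec.subspace X \<Longrightarrow> subspace X"
  by (auto simp: subspace_def vec.subspace_def restr_scale_def)

text \<open>
  Scalars from \<open>L\<close> can be moved from one argument of the dot product to the other.
\<close>

lemma large_subspace_perp:
  assumes "vec.subspace X"
  shows "vec.subspace (perp X)"
proof -
  have "a *s v \<in> perp X" if "v \<in> perp X" for a v
    unfolding perp_def
  proof clarify
    fix u assume "u \<in> X"
    then have "B (a *s u) v = 0"
      using that assms vec.subspace_scale unfolding perp_def by blast
    then show "B u (a *s v) = 0" by (simp add: B_eq dot_scale_left dot_scale_right)
  qed
  then show ?thesis
    using subspace_perp[of X] by (auto simp: subspace_def vec.subspace_def)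
qed

text \<open>
  From left to right, multiplication by a fixed scalar of \<open>L\<close> is \<open>K\<close>-linear and maps every
  spread element into itself, hence also their \<open>K\<close>-span. Conversely an \<open>L\<close>-subspace is the
  union of the spread elements in it, up to the zero vector.
\<close>

lemma generated_by_standard_spread_iff:
  "(\<exists>S\<subseteq>standard_spread. H = span (\<Union>S)) \<longleftrightarrow> vec.subspace H"
proof
  assume "\<exists>S\<subseteq>standard_spread. H = span (\<Union>S)"
  then obtain S where S: "S \<subseteq> standard_spread" "H = span (\<Union>S)" by blast
  have "a *s v \<in> H" if "v \<in> H" for a v
  proof -
    have "subspace {v. a *s v \<in> H}"
    proof (rule subspaceI)
      fix c x assume "x \<in> {v. a *s v \<in> H}"
      then have "restr_scale \<phi> c (a *s x) \<in> H" using S span_scale by simp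
      then show "restr_scale \<phi> c x \<in> {v. a *s v \<in> H}"
        by (simp add: restr_scale_def vector_smult_assoc mult.commute)
    qed (use S span_zero span_add in \<open>auto simp: vec.scale_right_distrib\<close>)
    moreover have "\<Union>S \<subseteq> {v. a *s v \<in> H}"
    proof clarify
      fix x X assume "x \<in> X" "X \<in> S"
      then have "a *s x \<in> X"
        using S(1) vec.subspace_scale by (auto simp: standard_spread_def)
      then have "a *s x \<in> \<Union>S" using \<open>X \<in> S\<close> by blast
      then show "a *s x \<in> H" using S(2) span_base by blast
    qed
    ultimately have "H \<subseteq> {v. a *s v \<in> H}" using S(2) span_minimal by blast
    then show ?thesis using that by blast
  qed
  then show "vec.subspace H"
    using S span_zero span_add by (auto simp: vec.subspace_def)
next
  assume H: "vec.subspace H"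
  let ?S = "{X \<in> standard_spread. X \<subseteq> H}"
  have "span (\<Union>?S) \<subseteq> H"
    by (rule span_minimal) (use H subspace_if_large_subspace in auto)
  moreover have "v \<in> span (\<Union>?S)" if "v \<in> H" for v
  proof (cases "v = 0")
    case False
    have "vec.span {v} \<subseteq> H" using H that by (intro vec.span_minimal) auto
    then have "v \<in> \<Union>?S"
      using line_in_standard_spread[OF False] vec.span_base[of v "{v}"] by blast
    then show ?thesis by (rule span_base)
  qed (simp add: span_zero)
  ultimately show "\<exists>S\<subseteq>standard_spread. H = span (\<Union>S)"
    by (intro exI[of _ ?S]) auto
qed

lemma dim_eq_n_iff: "subspace X \<Longrightarrow> dim X = n \<longleftrightarrow> card X = CARD('l)"
  using dim_eq_iff_card card_large by simp

lemma dim_eq_codim_n_iff: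
  assumes "subspace X"
  shows "dim X = CARD('r) * n - n \<longleftrightarrow> card (perp X) = CARD('l)"
proof -
  let ?q = "CARD('k)" and ?m = "CARD('r) * n - n"
  have "n \<le> n * CARD('r)" by simp
  then have "?m + n = n * CARD('r)" by (simp add: mult.commute)
  then have "?q ^ ?m * ?q ^ n = CARD('l ^ 'r)"
    by (simp add: card_large mult.commute flip: power_add power_mult)
  then have eq: "card X * card (perp X) = ?q ^ ?m * CARD('l)"
    using card_perp[OF assms] card_large by simp
  have "card X \<noteq> 0" using subspace_0[OF assms] by (auto simp: card_eq_0_iff)
  then have "card X = ?q ^ ?m \<longleftrightarrow> card (perp X) = CARD('l)"
    using eq by (metis mult_cancel1 mult_cancel2 zero_less_card_finite less_irrefl)
  then show ?thesis
    using dim_eq_iff_card[OF assms] by simp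
qed

lemma n_spread_standard: "n_spread (restr_scale \<phi>) n (standard_spread :: ('l ^ 'r) set set)"
  unfolding n_spread_def
proof (intro conjI ballI allI impI)
  fix X :: "('l ^ 'r) set" assume "X \<in> standard_spread"
  then show "subspace X" "dim X = n"
    using subspace_if_large_subspace[of X] dim_eq_n_iff by (auto simp: standard_spread_iff)
next
  fix v :: "'l ^ 'r" assume "v \<noteq> 0"
  then show "\<exists>!X. X \<in> standard_spread \<and> v \<in> X"
    using line_in_standard_spread standard_spread_unique vec.span_base[of v "{v}"]
    by (intro ex1I[of _ "vec.span {v}"]) auto
qed

text \<open>
  A \<open>K\<close>-linear bijection carries dimensions and the partition property along, so being a spread
  is inherited from the standard spread.
\<close>

lemma desarguesian_spread_preimage:
  assumes lin: "Vector_Spaces.linear (restr_scale \<phi>) (restr_scale \<phi>) f"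
    and bij: "bij (f :: 'l ^ 'r \<Rightarrow> 'l ^ 'r)"
  shows "desarguesian_spread \<phi> n ((-`) f ` standard_spread)"
proof -
  interpret f: Vector_Spaces.linear "restr_scale \<phi>" "restr_scale \<phi>" f by (rule lin)
  have card: "card (f -` Y) = card Y" for Y
    using bij by (intro card_vimage_inj) (auto simp: bij_def)
  have "n_spread (restr_scale \<phi>) n ((-`) f ` standard_spread)"
    unfolding n_spread_def
  proof (intro conjI ballI allI impI)
    fix X assume "X \<in> (-`) f ` standard_spread"
    then obtain Y where Y: "Y \<in> standard_spread" "X = f -` Y" by blast
    then have "subspace Y"
      using n_spread_standard by (auto simp: n_spread_def)
    then show X: "subspace X" using Y f.subspace_vimage by simp
    show "dim X = n"
      using Y card[of Y] dim_eq_n_iff[OF X] by (simp add: standard_spread_iff)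
  next
    fix v :: "'l ^ 'r" assume "v \<noteq> 0"
    then have "f v \<noteq> 0" using bij f.zero by (metis bij_def injD)
    then have "\<exists>!Y. Y \<in> standard_spread \<and> f v \<in> Y"
      using n_spread_standard by (auto simp: n_spread_def)
    then show "\<exists>!X. X \<in> (-`) f ` standard_spread \<and> v \<in> X" by auto
  qed
  moreover have "(\<lambda>X. f ` X) ` (-`) f ` standard_spread = standard_spread"
    using bij by (simp add: image_image bij_def surj_image_vimage_eq)
  ultimately show ?thesis
    unfolding desarguesian_spread_def using lin bij by blast
qed

lemma standard_spread_desarguesian: "desarguesian_spread \<phi> n (standard_spread :: ('l ^ 'r) set set)"
  using desarguesian_spread_preimage[OF linear_id] by (simp add: bij_id)

lemma perp_hyperplanes_eq_standard_spread:
  "perp ` {H. dim H = CARD('r) * n - n \<and> (\<exists>S\<subseteq>standard_spread. H = span (\<Union>S))}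
    = standard_spread"
  unfolding generated_by_standard_spread_iff
proof (intro set_eqI iffI)
  fix X assume "X \<in> perp ` {H. dim H = CARD('r) * n - n \<and> vec.subspace H}"
  then show "X \<in> standard_spread"
    using dim_eq_codim_n_iff subspace_if_large_subspace large_subspace_perp
    by (auto simp: standard_spread_iff)
next
  fix X :: "('l ^ 'r) set" assume "X \<in> standard_spread"
  then have X: "vec.subspace X" "card X = CARD('l)" by (auto simp: standard_spread_iff)
  then have pp: "perp (perp X) = X" by (intro perp_perp subspace_if_large_subspace)
  then have "dim (perp X) = CARD('r) * n - n"
    using X dim_eq_codim_n_iff[OF subspace_perp] by simp
  then show "X \<in> perp ` {H. dim H = CARD('r) * n - n \<and> vec.subspace H}"
    using X pp large_subspace_perp by (intro image_eqI[of _ _ "perp X"]) auto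
qed

definition common_line :: "('l ^ 'r) set \<Rightarrow> ('l ^ 'r) set \<Rightarrow> bool" where
  "common_line U W \<longleftrightarrow>
     spread_elements_meeting standard_spread U \<inter> spread_elements_meeting standard_spread W \<noteq> {}"

lemma common_line_iff:
  "common_line U W \<longleftrightarrow> (\<exists>X\<in>standard_spread. (\<exists>u\<in>U. u \<noteq> 0 \<and> u \<in> X) \<and> (\<exists>w\<in>W. w \<noteq> 0 \<and> w \<in> X))"
  by (auto simp: common_line_def spread_elements_meeting_def)

lemma common_line_if_scaled:
  assumes "u \<in> U" "a *s u \<in> W" "u \<noteq> 0" "a \<noteq> 0"
  shows "common_line U W"
  unfolding common_line_iff
proof (intro bexI conjI)
  show "vec.span {u} \<in> standard_spread" using assms by (simp add: line_in_standard_spread)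
  show u: "u \<in> vec.span {u}" by (simp add: vec.span_base)
  then show "a *s u \<in> vec.span {u}" by (rule vec.span_scale)
  show "a *s u \<noteq> 0" using assms by simp
qed (use assms in auto)

lemma common_line_scaledE:
  assumes "common_line U W"
  obtains u a where "u \<in> U" "a *s u \<in> W" "u \<noteq> 0" "a \<noteq> 0"
proof -
  obtain X u w where X: "X \<in> standard_spread" and u: "u \<in> U" "u \<noteq> 0" "u \<in> X"
    and w: "w \<in> W" "w \<noteq> 0" "w \<in> X"
    using assms by (auto simp: common_line_iff)
  have "w \<in> vec.span {u}" using standard_spread_unique[OF X u(3,2)] w by simp
  then obtain a where a: "w = a *s u" by (auto simp: vec.span_singleton)
  then have "a \<noteq> 0" using w by auto
  then show ?thesis using that u w a by blast
qed

lemma dot_zero_right [simp]: "dot u (0 :: 'l ^ 'r) = 0"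
  by (simp add: dot_def)

text \<open>
  Take a spread element that contains \<open>y \<in> perp W\<close> and \<open>a y \<in> perp U\<close>. The values
  \<open>u \<bullet> (a y)\<close> for \<open>u \<in> U\<close> lie in the kernel of \<open>lam\<close>, so they do not exhaust \<open>L\<close>;
  as \<open>U\<close> has the size of \<open>L\<close>, two of them coincide, which yields a nonzero \<open>u \<in> U\<close>
  with \<open>u \<bullet> y = 0\<close>. Then \<open>y\<close> is in the kernel of \<open>w \<mapsto> u \<bullet> w\<close> on \<open>perp W\<close>, which also
  has the size of \<open>L\<close>, so that the image \<open>P\<close> of this map is a proper subspace of \<open>L\<close>.
  Some \<open>c \<noteq> 0\<close> satisfies \<open>lam (c p) = 0\<close> for all \<open>p \<in> P\<close>. This says that \<open>c u\<close> is
  orthogonal to \<open>perp W\<close>, that is, \<open>c u \<in> W\<close>, and the spread element of \<open>u\<close> meets both.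
\<close>

lemma common_line_if_perps:
  assumes U: "subspace U" "card U = CARD('l)" and W: "subspace W" "card (perp W) = CARD('l)"
    and "common_line (perp W) (perp U)"
  shows "common_line U W"
proof -
  obtain y a where y: "y \<in> perp W" "a *s y \<in> perp U" "y \<noteq> 0" "a \<noteq> 0"
    using assms(5) by (rule common_line_scaledE)
  have "\<not> inj_on (\<lambda>u. dot u (a *s y)) U"
  proof
    assume "inj_on (\<lambda>u. dot u (a *s y)) U"
    then have "card ((\<lambda>u. dot u (a *s y)) ` U) = CARD('l)" using U by (simp add: card_image)
    then have "1 \<in> (\<lambda>u. dot u (a *s y)) ` U" using card_eq_UNIV_imp_eq_UNIV[OF finite] by blast
    then obtain u where "u \<in> U" "1 = dot u (a *s y)" by (rule imageE)
    moreover have "lam (dot u (a *s y)) = 0" using y(2) \<open>u \<in> U\<close> by (simp add: perp_def B_eq)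
    ultimately have "lam 1 = 0" by metis
    then show False using lam_1 by simp
  qed
  then obtain u1 u2 where u12: "u1 \<in> U" "u2 \<in> U" "u1 \<noteq> u2" "dot u1 (a *s y) = dot u2 (a *s y)"
    by (auto simp: inj_on_def)
  define u where "u = u1 - u2"
  have u: "u \<in> U" "u \<noteq> 0" using u12 U subspace_diff by (auto simp: u_def)
  have "dot u1 (a *s y) = dot u (a *s y) + dot u2 (a *s y)"
    by (simp add: u_def flip: dot_add_left)
  then have uy: "dot u y = 0" using u12 y by (simp add: dot_scale_right)
  let ?P = "dot u ` perp W"
  have "\<not> inj_on (dot u) (perp W)"
    using y(1,3) uy subspace_0[OF subspace_perp, of W] dot_zero_right by (metis inj_onD)
  then have "card ?P \<noteq> card (perp W)" using eq_card_imp_inj_on[OF finite] by metis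
  moreover have P: "small.subspace ?P"
  proof (rule small.subspaceI)
    show "0 \<in> ?P" using subspace_0[OF subspace_perp, of W] by (intro image_eqI[of _ _ 0]) auto
    show "x + y \<in> ?P" if "x \<in> ?P" "y \<in> ?P" for x y
      using that subspace_add[OF subspace_perp, of _ W]
      by (auto simp flip: dot_add_right)
    show "\<phi> c * x \<in> ?P" if "x \<in> ?P" for c x
      using that subspace_scale[OF subspace_perp, of _ W c]
      by (auto simp: restr_scale_def simp flip: dot_scale_right)
  qed
  ultimately have "small.perp ?P \<noteq> {0}"
    using small.card_perp[OF P] W by auto
  then obtain c where c: "c \<in> small.perp ?P" "c \<noteq> 0"
    using small.subspace_0[OF small.subspace_perp] by blast
  have "c *s u \<in> perp (perp W)"
    using c by (auto simp: perp_def small.perp_def B_eq dot_scale_right dot_commute[of _ u] mult.commute)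
  then show ?thesis
    using common_line_if_scaled[of u U c W] u c perp_perp[OF W(1)] by simp
qed

text \<open>
  The hypotheses are stable under replacing \<open>(U, W)\<close> by \<open>(perp W, perp U)\<close>, and doing so
  twice gives back \<open>(U, W)\<close>; so one direction implies the other.
\<close>

lemma common_line_perps_iff:
  assumes U: "subspace U" "card U = CARD('l)" and W: "subspace W" "card (perp W) = CARD('l)"
  shows "common_line (perp W) (perp U) \<longleftrightarrow> common_line U W"
proof
  assume "common_line U W"
  show "common_line (perp W) (perp U)"
    by (rule common_line_if_perps[OF subspace_perp W(2) subspace_perp])
      (simp_all add: U W perp_perp \<open>common_line U W\<close>)
qed (rule common_line_if_perps[OF assms])

end

section \<open>Polarities\<close>

text \<open>
  A left inverse of the embedding of \<open>K\<close> into \<open>L\<close>, taken as \<open>K\<close>-linear map.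
\<close>

lemma exists_normalised_functional:
  fixes \<phi> :: "'k::{field,finite} \<Rightarrow> 'l::{field,finite}"
  assumes "field_embedding \<phi>"
  shows "\<exists>lam. (\<forall>x y. lam (x + y) = lam x + lam y) \<and> (\<forall>c x. lam (\<phi> c * x) = c * lam x) \<and> lam 1 = (1 :: 'k)"
proof -
  have K: "vector_space ((*) :: 'k \<Rightarrow> 'k \<Rightarrow> 'k)" and L: "vector_space (\<lambda>c x :: 'l. \<phi> c * x)"
    using assms by (unfold_locales; simp add: field_embedding_def algebra_simps)+
  then interpret vector_space_pair "(*) :: 'k \<Rightarrow> 'k \<Rightarrow> 'k" "\<lambda>c x :: 'l. \<phi> c * x"
    by (simp add: vector_space_pair_def)
  have "Vector_Spaces.linear (*) (\<lambda>c x. \<phi> c * x) \<phi>"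
    using K L assms by (simp add: Vector_Spaces.linear_iff field_embedding_def)
  then obtain lam where lam: "Vector_Spaces.linear (\<lambda>c x. \<phi> c * x) (*) lam" "lam \<circ> \<phi> = id"
    using linear_injective_left_inverse[OF _ inj_field_embedding[OF assms]] by blast
  have "lam (\<phi> 1) = 1" using lam(2) by (metis comp_apply id_apply)
  then show ?thesis
    using lam(1) assms by (intro exI[of _ lam]) (simp add: Vector_Spaces.linear_iff field_embedding_def)
qed

definition sesquilinear_form ::
    "('k::field \<Rightarrow> 'v::ab_group_add \<Rightarrow> 'v) \<Rightarrow> ('k \<Rightarrow> 'k) \<Rightarrow> ('v \<Rightarrow> 'v \<Rightarrow> 'k) \<Rightarrow> bool" where
  "sesquilinear_form s \<sigma> b \<longleftrightarrow>
     (\<forall>u u' v. b (u + u') v = b u v + b u' v) \<and> (\<forall>c u v. b (s c u) v = c * b u v) \<and>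
     (\<forall>u v v'. b u (v + v') = b u v + b u v') \<and> (\<forall>c u v. b u (s c v) = \<sigma> c * b u v)"

definition semilinear_bijection ::
    "('k::field \<Rightarrow> 'v::ab_group_add \<Rightarrow> 'v) \<Rightarrow> ('k \<Rightarrow> 'k) \<Rightarrow> ('v \<Rightarrow> 'v) \<Rightarrow> bool" where
  "semilinear_bijection s \<sigma> T \<longleftrightarrow>
     bij T \<and> (\<forall>u v. T (u + v) = T u + T v) \<and> (\<forall>c v. T (s c v) = s (\<sigma> c) (T v))"

text \<open>
  The three kinds of forms are treated at once: \<open>\<sigma>\<close> is the identity for a symmetric or
  alternating form, and the companion automorphism for a hermitian one.
\<close>

lemma nondegenerate_polarity_sesquilinear:
  assumes "nondegenerate_polarity s \<rho>"
  shows "\<exists>b \<sigma>. field_embedding \<sigma> \<and> \<sigma> \<circ> \<sigma> = id \<and> sesquilinear_form s \<sigma> b \<and>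
    nondegenerate_form b \<and> (\<forall>M. module.subspace s M \<longrightarrow> \<rho> M = {v. \<forall>u\<in>M. b u v = 0})"
proof -
  obtain b where b: "nondegenerate_form b"
      "\<forall>M. module.subspace s M \<longrightarrow> \<rho> M = {v. \<forall>u\<in>M. b u v = 0}"
    and cases: "symmetric_bilinear_form s b \<or> alternating_form s b \<or> hermitian_form s b"
    using assms unfolding nondegenerate_polarity_def by blast
  from cases have "bilinear_form s b \<or> hermitian_form s b"
    by (auto simp: symmetric_bilinear_form_def alternating_form_def)
  then have "\<exists>\<sigma>. field_embedding \<sigma> \<and> \<sigma> \<circ> \<sigma> = id \<and> sesquilinear_form s \<sigma> b"
  proof
    assume "bilinear_form s b"
    then show ?thesis
      by (intro exI[of _ id])
        (simp add: bilinear_form_def sesquilinear_form_def Vector_Spaces.linear_iff field_embedding_def)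
  next
    assume "hermitian_form s b"
    then obtain \<sigma> where \<sigma>: "field_embedding \<sigma>" "\<sigma> \<circ> \<sigma> = id"
      and lin: "\<And>v. Vector_Spaces.linear s (*) (\<lambda>u. b u v)" and herm: "\<And>u v. b v u = \<sigma> (b u v)"
      unfolding hermitian_form_def by blast
    have left: "b (u + u') v = b u v + b u' v" "b (s c u) v = c * b u v" for u u' v c
      using lin by (auto simp: Vector_Spaces.linear_iff)
    have "b u (v + v') = b u v + b u v'" for u v v'
      using \<sigma>(1) left(1) herm unfolding field_embedding_def by metis
    moreover have "b u (s c v) = \<sigma> c * b u v" for u v c
      using \<sigma>(1) left(2) herm unfolding field_embedding_def by metis
    ultimately have "sesquilinear_form s \<sigma> b"
      using left by (simp add: sesquilinear_form_def)
    then show ?thesis using \<sigma> by blast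
  qed
  then show ?thesis using b by blast
qed

lemma standard_spread_preimage_semilinear:
  fixes \<tau> :: "'l::{field,finite} \<Rightarrow> 'l" and S :: "'l ^ 'r \<Rightarrow> 'l ^ 'r"
  assumes bij: "bij S" and add: "\<And>u v. S (u + v) = S u + S v"
    and scale: "\<And>a v. S (a *s v) = \<tau> a *s S v"
  shows "(-`) S ` standard_spread = standard_spread"
proof (rule endo_inj_surj)
  show "(-`) S ` standard_spread \<subseteq> standard_spread"
  proof clarify
    fix Y :: "('l ^ 'r) set" assume "Y \<in> standard_spread"
    then have Y: "vec.subspace Y" "card Y = CARD('l)" by (auto simp: standard_spread_iff)
    have "S 0 = 0" using add[of 0 0] by simp
    then have "vec.subspace (S -` Y)"
      using Y(1) by (auto simp: vec.subspace_def add scale)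
    moreover have "card (S -` Y) = card Y"
      using bij by (intro card_vimage_inj) (auto simp: bij_def)
    ultimately show "S -` Y \<in> standard_spread" using Y by (simp add: standard_spread_iff)
  qed
  show "inj_on ((-`) S) standard_spread"
    using bij by (metis bij_def inj_onI surj_image_vimage_eq)
qed simp

context functional_form
begin

text \<open>
  Let \<open>S\<close> apply to each coordinate an extension \<open>\<tau>\<close> of \<open>\<sigma>\<close> to \<open>L\<close>. Since
  \<open>\<sigma> \<circ> \<sigma> = id\<close>, the composition \<open>S \<circ> T\<close> is \<open>K\<close>-linear, and \<open>S\<close> preserves the
  standard spread, so \<open>T\<close> and \<open>S \<circ> T\<close> give the same preimage of it.
\<close>

lemma desarguesian_spread_semilinear_preimage:
  fixes T :: "'l ^ 'r \<Rightarrow> 'l ^ 'r"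
  assumes \<sigma>: "field_embedding \<sigma>" "\<sigma> \<circ> \<sigma> = id"
    and T: "semilinear_bijection (restr_scale \<phi>) \<sigma> T"
  shows "desarguesian_spread \<phi> n ((-`) T ` (standard_spread :: ('l ^ 'r) set set))"
proof -
  have bij: "bij T" and add: "T (u + v) = T u + T v"
    and scale: "T (restr_scale \<phi> c v) = restr_scale \<phi> (\<sigma> c) (T v)" for u v c
    using T by (auto simp: semilinear_bijection_def)
  obtain \<tau> where \<tau>: "field_embedding \<tau>" "\<And>c. \<tau> (\<phi> c) = \<phi> (\<sigma> c)"
    using involution_extends[OF embedding \<sigma>] by blast
  have \<tau>_hom: "\<tau> (x + y) = \<tau> x + \<tau> y" "\<tau> (x * y) = \<tau> x * \<tau> y" for x y
    using \<tau>(1) by (auto simp: field_embedding_def)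
  define S :: "'l ^ 'r \<Rightarrow> 'l ^ 'r" where "S v = (\<chi> i. \<tau> (v $ i))" for v
  have S_add: "S (u + v) = S u + S v" and S_scale: "S (a *s v) = \<tau> a *s S v" for u v a
    by (simp_all add: S_def vec_eq_iff \<tau>_hom)
  have "inj S"
    using injD[OF inj_field_embedding[OF \<tau>(1)]]
    by (intro injI) (auto simp: S_def vec_eq_iff)
  then have bij_S: "bij S" by (simp add: bij_def finite_UNIV_inj_surj)
  have inv: "\<sigma> (\<sigma> c) = c" for c using \<sigma>(2) by (metis comp_apply id_apply)
  have "(S \<circ> T) (restr_scale \<phi> c v) = restr_scale \<phi> c ((S \<circ> T) v)" for c v
    by (simp add: scale) (simp add: restr_scale_def S_scale \<tau>(2) inv)
  then have "Vector_Spaces.linear (restr_scale \<phi>) (restr_scale \<phi>) (S \<circ> T)"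
    using vector_space_axioms by (simp add: Vector_Spaces.linear_iff add S_add)
  then have "desarguesian_spread \<phi> n ((-`) (S \<circ> T) ` (standard_spread :: ('l ^ 'r) set set))"
    using bij bij_S by (intro desarguesian_spread_preimage bij_comp)
  moreover have "(-`) (S \<circ> T) ` (standard_spread :: ('l ^ 'r) set set)
      = (-`) T ` (-`) S ` standard_spread"
    by (simp add: image_image vimage_comp)
  ultimately show ?thesis
    using standard_spread_preimage_semilinear[OF bij_S S_add S_scale] by simp
qed

text \<open>
  \<open>T v\<close> is the vector that represents the functional \<open>u \<mapsto> b u v\<close> with respect to \<open>B\<close>.
\<close>

lemma form_eq_functional_form_semilinear:
  assumes b: "sesquilinear_form (restr_scale \<phi>) \<sigma> b" and nondeg: "nondegenerate_form b"
  shows "\<exists>T. semilinear_bijection (restr_scale \<phi>) \<sigma> T \<and> (\<forall>u v. b u v = B u (T v))"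
proof -
  have add: "b u (v + v') = b u v + b u v'" and scale: "b u (restr_scale \<phi> c v) = \<sigma> c * b u v"
    for u v v' c
    using b by (auto simp: sesquilinear_form_def)
  have "\<exists>a. \<forall>u. b u v = B u a" for v
    by (rule riesz_representation) (use b in \<open>auto simp: sesquilinear_form_def\<close>)
  then obtain T where T: "\<And>u v. b u v = B u (T v)" by metis
  have eqI: "x = y" if "\<And>u. B u x = B u y" for x y
  proof -
    have "B u (x - y) = 0" for u
      using B_add_right[of u "x - y" y] that by simp
    then show ?thesis using nondegenerate[of "x - y"] by simp
  qed
  have T_add: "T (u + v) = T u + T v" for u v
    by (rule eqI) (simp add: B_add_right add flip: T)
  have "T (restr_scale \<phi> c v) = restr_scale \<phi> (\<sigma> c) (T v)" for c v
    by (rule eqI) (simp add: B_scale_right scale flip: T)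
  moreover have "inj T"
  proof (rule injI)
    fix x y assume "T x = T y"
    then have "T (x - y) = 0" using T_add[of "x - y" y] by simp
    then have "b u (x - y) = 0" for u by (simp add: T)
    then have "x - y = 0" using nondeg unfolding nondegenerate_form_def by blast
    then show "x = y" by simp
  qed
  then have "bij T" by (simp add: bij_def finite_UNIV_inj_surj)
  ultimately have "semilinear_bijection (restr_scale \<phi>) \<sigma> T"
    using T_add by (simp add: semilinear_bijection_def)
  then show ?thesis using T by blast
qed

lemma BEL_standard_iff:
  assumes "subspace U" "subspace W"
  shows "BEL_configuration \<phi> n standard_spread U W \<longleftrightarrow>
    card U = CARD('l) \<and> card (perp W) = CARD('l) \<and> \<not> common_line U W"
  using assms standard_spread_desarguesian
  by (auto simp: BEL_configuration_def dim_eq_n_iff dim_eq_codim_n_iff common_line_def)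

lemma BEL_preimage_iff:
  fixes T :: "'l ^ 'r \<Rightarrow> 'l ^ 'r"
  assumes \<sigma>: "field_embedding \<sigma>" "\<sigma> \<circ> \<sigma> = id"
    and T: "semilinear_bijection (restr_scale \<phi>) \<sigma> T"
    and "subspace U" "subspace W"
  shows "BEL_configuration \<phi> n ((-`) T ` standard_spread) (T -` U) (T -` W) \<longleftrightarrow>
    BEL_configuration \<phi> n standard_spread U W"
proof -
  have bij: "bij T" and add: "T (u + v) = T u + T v"
    and scale: "T (restr_scale \<phi> c v) = restr_scale \<phi> (\<sigma> c) (T v)" for u v c
    using T by (auto simp: semilinear_bijection_def)
  have T0: "T 0 = 0" using add[of 0 0] by simp
  have T0_iff: "T v = 0 \<longleftrightarrow> v = 0" for v
    using bij T0 by (metis bij_def injD)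
  have card: "card (T -` X) = card X" for X
    using bij by (intro card_vimage_inj) (auto simp: bij_def)
  have sub: "subspace (T -` X)" if "subspace X" for X
    using that T0 by (auto simp: subspace_def add scale)
  have dim: "dim (T -` X) = dim X" if "subspace X" for X
    using that sub[OF that] card[of X] dim_eq_iff_card by metis
  have meet: "(\<exists>v\<in>T -` A. v \<noteq> 0 \<and> v \<in> T -` X) \<longleftrightarrow> (\<exists>v\<in>A. v \<noteq> 0 \<and> v \<in> X)" for A X
  proof -
    have "T ` (T -` A) = A" using bij by (simp add: bij_def surj_image_vimage_eq)
    then have "(\<exists>v\<in>A. v \<noteq> 0 \<and> v \<in> X) \<longleftrightarrow> (\<exists>v\<in>T ` (T -` A). v \<noteq> 0 \<and> v \<in> X)"
      by (simp only:)
    then show ?thesis by (simp only: bex_simps T0_iff vimage_eq)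
  qed
  have "spread_elements_meeting ((-`) T ` standard_spread) (T -` A)
      = (-`) T ` spread_elements_meeting standard_spread A" for A
  proof -
    have "spread_elements_meeting ((-`) T ` standard_spread) (T -` A)
        = (-`) T ` {Y \<in> standard_spread. \<exists>v\<in>T -` A. v \<noteq> 0 \<and> v \<in> T -` Y}"
      unfolding spread_elements_meeting_def by blast
    then show ?thesis by (simp only: meet spread_elements_meeting_def)
  qed
  moreover have "inj ((-`) T)"
    using bij by (metis bij_def inj_onI surj_image_vimage_eq)
  ultimately have "spread_elements_meeting ((-`) T ` standard_spread) (T -` U)
      \<inter> spread_elements_meeting ((-`) T ` standard_spread) (T -` W)
    = (-`) T ` (spread_elements_meeting standard_spread U \<inter> spread_elements_meeting standard_spread W)"
    by (simp add: image_Int)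
  then show ?thesis
    using assms(4,5) sub dim desarguesian_spread_semilinear_preimage[OF \<sigma> T]
      standard_spread_desarguesian
    by (simp add: BEL_configuration_def)
qed

text \<open>
  Orthogonality exchanges dimension \<open>n\<close> with dimension \<open>rn - n\<close>, which is why \<open>U\<close> and
  \<open>W\<close> change places.
\<close>

lemma BEL_perp_iff:
  assumes U: "subspace U" and W: "subspace W"
  shows "BEL_configuration \<phi> n standard_spread (perp W) (perp U) \<longleftrightarrow>
    BEL_configuration \<phi> n standard_spread U W"
  using U W common_line_perps_iff[OF U _ W]
  by (auto simp: BEL_standard_iff subspace_perp perp_perp)

end

theorem theorem5:
  fixes \<phi> :: "'k::{field,finite} \<Rightarrow> 'l::{field,finite}"
    and n :: nat
    and \<rho> :: "('l ^ 'r) set \<Rightarrow> ('l ^ 'r) set"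
    and U W :: "('l ^ 'r) set"
  assumes "field_embedding \<phi>"
    and "CARD('l) = CARD('k) ^ n"
    and "nondegenerate_polarity (restr_scale \<phi>) \<rho>"
    and "module.subspace (restr_scale \<phi>) U"
    and "module.subspace (restr_scale \<phi>) W"
  shows "BEL_configuration \<phi> n standard_spread U W \<longleftrightarrow>
         BEL_configuration \<phi> n (dual_spread \<phi> n \<rho> standard_spread) (\<rho> W) (\<rho> U)"
proof -
  obtain lam where "\<And>x y. lam (x + y) = lam x + lam y" "\<And>c x. lam (\<phi> c * x) = c * lam x"
    "lam 1 = (1 :: 'k)"
    using exists_normalised_functional[OF assms(1)] by blast
  then interpret functional_form \<phi> n lam "\<lambda>u v :: 'l ^ 'r. lam (dot u v)"
    using assms by unfold_locales simp_all
  obtain b \<sigma> where \<sigma>: "field_embedding \<sigma>" "\<sigma> \<circ> \<sigma> = id"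
    and b: "sesquilinear_form (restr_scale \<phi>) \<sigma> b" "nondegenerate_form b"
    and \<rho>: "\<forall>M. subspace M \<longrightarrow> \<rho> M = {v. \<forall>u\<in>M. b u v = 0}"
    using nondegenerate_polarity_sesquilinear[OF assms(3)] by blast
  obtain T where T: "semilinear_bijection (restr_scale \<phi>) \<sigma> T"
    and bT: "\<And>u v. b u v = lam (dot u (T v))"
    using form_eq_functional_form_semilinear[OF b] by blast
  have \<rho>_eq: "\<rho> M = T -` perp M" if "subspace M" for M
    using \<rho> that by (auto simp: perp_def bT)
  have "dual_spread \<phi> n \<rho> standard_spread
      = \<rho> ` {H. dim H = CARD('r) * n - n \<and> (\<exists>S\<subseteq>standard_spread. H = span (\<Union>S))}"
    by (auto simp: dual_spread_def)
  also have "\<dots> = (-`) T ` perp ` {H. dim H = CARD('r) * n - n \<and> (\<exists>S\<subseteq>standard_spread. H = span (\<Union>S))}"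
    unfolding image_image by (intro image_cong refl) (auto simp: \<rho>_eq)
  finally have "dual_spread \<phi> n \<rho> standard_spread = (-`) T ` standard_spread"
    by (simp only: perp_hyperplanes_eq_standard_spread)
  then show ?thesis
    using BEL_preimage_iff[OF \<sigma> T subspace_perp subspace_perp] BEL_perp_iff assms(4,5) \<rho>_eq
    by simp
qed

end
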